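(* Let $n$ be an integer with $2^{20} < n \leq 10^{16}$, and suppose $n = p_1 p_2 \cdots p_k$ is square-free, where $p_1, \dots, p_k$ are distinct primes. Then $$\sum_{j=1}^{k} \left(\lfloor \log_2 p_j \rfloor \,|\, 1\right) \;\geq\; \lfloor \log_2 n \rfloor - 7,$$ and, if moreover $p_k > \sqrt{n}$, then $$\sum_{j=1}^{k-1} \left(\lfloor \log_2 p_j \rfloor \,|\, 1\right) \;<\; \lfloor \log_2 n \rfloor - 7.$$
   Context: For a nonnegative integer $m$, $m \,|\, 1$ denotes the bitwise OR of $m$ with $1$; that is, $m\,|\,1 = m$ if $m$ is odd and $m\,|\,1 = m+1$ if $m$ is even. *)

theory Defs
  imports Complex_Main "HOL-Computational_Algebra.Squarefree"
begin

unbundle bit_operations_syntax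

end

theory Submission
  imports Defs
begin

text \<open>
  Write \<open>w p\<close> for \<open>\<lfloor>log 2 p\<rfloor> OR 1\<close>. For every prime \<open>p\<close> outside
  \<open>{3, 11, 13, 53, 59, 61}\<close> one has \<open>w p \<ge> 7/8 log 2 p\<close>, and for every prime \<open>p\<close> outside
  \<open>{5, 17, 19}\<close> one has \<open>w p \<le> 7/6 log 2 p\<close>. Since the primes are distinct, each exception costs
  its defect at most once, and the total defects are small enough for the range of \<open>n\<close>: the
  first bound needs \<open>n * C < 2 ^ 64\<close>, and in the second the product of the remaining primes is
  below \<open>sqrt n\<close>, so that \<open>7/12 log 2 n\<close> plus the defect stays below \<open>\<lfloor>log 2 n\<rfloor> - 7\<close> once
  \<open>n > 2 ^ 20\<close>.
\<close>

section \<open>The rounded-up-to-odd binary logarithm\<close>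

text \<open>Natural-valued so that it can serve as an exponent. For \<open>p > 0\<close> the floor
  is nonnegative, so \<open>nat\<close> truncates nothing.\<close>

definition log_or_one :: "nat \<Rightarrow> nat"
  where "log_or_one p = nat (\<lfloor>log 2 (real p)\<rfloor> OR 1)"

lemma floor_log2_obtain:
  fixes n :: nat
  assumes "n > 0"
  obtains f where "\<lfloor>log 2 (real n)\<rfloor> = int f" "2 ^ f \<le> n" "n < 2 ^ (f + 1)"
proof -
  have "\<lfloor>log 2 (real n)\<rfloor> \<ge> 0"
    using assms by simp
  then obtain f where f: "\<lfloor>log 2 (real n)\<rfloor> = int f"
    using nonneg_int_cases by blast
  then have "2 ^ f \<le> n \<and> n < 2 ^ (f + 1)"
    using floor_log_nat_eq_powr_iff[of 2 n f] assms by (simp add: add.commute)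
  with f that show ?thesis by blast
qed

lemma log_or_one_eq:
  assumes "\<lfloor>log 2 (real p)\<rfloor> = int f"
  shows "log_or_one p = f + of_bool (even f)"
  using assms by (simp add: log_or_one_def or_one_eq nat_add_distrib)

lemma int_log_or_one:
  assumes "p > 0"
  shows "int (log_or_one p) = \<lfloor>log 2 (real p)\<rfloor> OR 1"
  using assms by (simp add: log_or_one_def)

text \<open>The factor \<open>p ^ 7 / 2 ^ (8 * w p)\<close> at the exceptional primes.\<close>

definition lower_defect :: "nat \<Rightarrow> real"
  where "lower_defect p =
    (if p = 3 then 3 ^ 7 / 2 ^ 8 else if p = 11 then 11 ^ 7 / 2 ^ 24
     else if p = 13 then 13 ^ 7 / 2 ^ 24 else if p = 53 then 53 ^ 7 / 2 ^ 40
     else if p = 59 then 59 ^ 7 / 2 ^ 40 else if p = 61 then 61 ^ 7 / 2 ^ 40 else 1)"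

text \<open>The factor \<open>2 ^ (6 * w p) / p ^ 7\<close> at the exceptional primes.\<close>

definition upper_defect :: "nat \<Rightarrow> real"
  where "upper_defect p =
    (if p = 5 then 2 ^ 18 / 5 ^ 7 else if p = 17 then 2 ^ 30 / 17 ^ 7
     else if p = 19 then 2 ^ 30 / 19 ^ 7 else 1)"

section \<open>Estimates at a single prime\<close>

lemma prime_not_dvd:
  fixes p d :: nat
  assumes "prime p" "1 < d" "d < p"
  shows "\<not> d dvd p"
  using assms by (auto simp: prime_nat_iff)

text \<open>Let \<open>f\<close> be the floor of the logarithm. If \<open>f\<close> is even, the
  weight is \<open>f + 1\<close> and \<open>p < 2 ^ (f + 1)\<close> suffices. If \<open>f\<close> is
  odd, the weight is \<open>f\<close>, and \<open>7 * (f + 1) \<le> 8 * f\<close> holds from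
  \<open>f = 7\<close> on. Only \<open>f = 1, 3, 5\<close> need inspection.\<close>

lemma power7_le_log_or_one:
  assumes "prime p"
  shows "real p ^ 7 \<le> 2 ^ (8 * log_or_one p) * lower_defect p"
proof -
  obtain f where f: "\<lfloor>log 2 (real p)\<rfloor> = int f" and lo: "2 ^ f \<le> p" and hi: "p < 2 ^ (f + 1)"
    using floor_log2_obtain prime_gt_0_nat[OF assms] .
  note w = log_or_one_eq[OF f]
  have ge1: "lower_defect p \<ge> 1"
    by (simp add: lower_defect_def)
  have generic: ?thesis if "real p ^ 7 \<le> 2 ^ (8 * log_or_one p)"
    using order_trans[OF that, of "2 ^ (8 * log_or_one p) * lower_defect p"] ge1 by simp
  have hi7: "real p ^ 7 \<le> 2 ^ (7 * (f + 1))"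
  proof -
    have "real p \<le> 2 ^ (f + 1)"
      using of_nat_mono[OF less_imp_le[OF hi], where 'a = real] by simp
    then have "real p ^ 7 \<le> (2 ^ (f + 1)) ^ 7"
      by (intro power_mono) auto
    also have "\<dots> = 2 ^ (7 * (f + 1))"
      by (subst power_mult[symmetric]) (simp only: mult.commute)
    finally show ?thesis .
  qed
  consider "even f \<or> f \<ge> 7" | "f = 1" | "f = 3" | "f = 5"
  proof -
    have "f < 7 \<Longrightarrow> f \<in> {0, 1, 2, 3, 4, 5, 6}" by auto
    with that show thesis by fastforce
  qed
  then show ?thesis
  proof cases
    case 1
    then have "7 * (f + 1) \<le> 8 * log_or_one p"
      using w by auto
    then have "(2::real) ^ (7 * (f + 1)) \<le> 2 ^ (8 * log_or_one p)"
      by (intro power_increasing) auto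
    with hi7 show ?thesis by (intro generic) linarith
  next
    case 2
    then have "p \<in> {2, 3}" using lo hi by auto
    with 2 w show ?thesis by (auto simp: lower_defect_def)
  next
    case 3
    then have w': "log_or_one p = 3" using w by simp
    show ?thesis
    \<comment> \<open>\<open>10\<close> is the largest integer whose seventh power is at most
      \<open>2 ^ 24\<close>; sieving \<open>11..15\<close> by 2 and 3 leaves the exceptions.\<close>
    proof (cases "p \<le> 10")
      case True
      then have "real p ^ 7 \<le> 10 ^ 7" by (intro power_mono) auto
      then show ?thesis using w' by (intro generic) simp
    next
      case False
      then have "p \<in> set [11..<16]" using 3 hi by (simp only: set_upt) simp
      moreover have "\<not> 2 dvd p" "\<not> 3 dvd p"
        using False assms by (intro prime_not_dvd; simp)+
      ultimately have "p = 11 \<or> p = 13" by auto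
      with w' show ?thesis by (auto simp: lower_defect_def)
    qed
  next
    case 4
    then have w': "log_or_one p = 5" using w by simp
    show ?thesis
    \<comment> \<open>Likewise \<open>52 ^ 7 \<le> 2 ^ 40 < 53 ^ 7\<close>.\<close>
    proof (cases "p \<le> 52")
      case True
      then have "real p ^ 7 \<le> 52 ^ 7" by (intro power_mono) auto
      then show ?thesis using w' by (intro generic) simp
    next
      case False
      then have "p \<in> set [53..<64]" using 4 hi by (simp only: set_upt) simp
      moreover have "\<not> 2 dvd p" "\<not> 3 dvd p" "\<not> 5 dvd p"
        using False assms by (intro prime_not_dvd; simp)+
      ultimately have "p = 53 \<or> p = 59 \<or> p = 61" by auto
      with w' show ?thesis by (auto simp: lower_defect_def)
    qed
  qed
qed

text \<open>Now odd \<open>f\<close> is the easy case, and for even \<open>f\<close> the inequality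
  \<open>6 * (f + 1) \<le> 7 * f\<close> holds from \<open>f = 6\<close> on. The cutoffs 6 and 20
  below are the least integers whose seventh powers reach \<open>2 ^ 18\<close> and
  \<open>2 ^ 30\<close>.\<close>

lemma log_or_one_le_power7:
  assumes "prime p"
  shows "2 ^ (6 * log_or_one p) \<le> real p ^ 7 * upper_defect p"
proof -
  obtain f where f: "\<lfloor>log 2 (real p)\<rfloor> = int f" and lo: "2 ^ f \<le> p" and hi: "p < 2 ^ (f + 1)"
    using floor_log2_obtain prime_gt_0_nat[OF assms] .
  note w = log_or_one_eq[OF f]
  have ge1: "upper_defect p \<ge> 1"
    by (simp add: upper_defect_def)
  have generic: ?thesis if "2 ^ (6 * log_or_one p) \<le> real p ^ 7"
    using that mult_left_mono[OF ge1, of "real p ^ 7"] by simp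
  have lo7: "2 ^ (7 * f) \<le> real p ^ 7"
  proof -
    have "2 ^ f \<le> real p"
      using of_nat_mono[OF lo, where 'a = real] by simp
    then have "(2 ^ f) ^ 7 \<le> real p ^ 7"
      by (intro power_mono) auto
    then show ?thesis
      by (simp add: power_mult[symmetric] mult.commute)
  qed
  consider "odd f \<or> f \<ge> 6" | "f = 0" | "f = 2" | "f = 4"
  proof -
    have "f < 6 \<Longrightarrow> f \<in> {0, 1, 2, 3, 4, 5}" by auto
    with that show thesis by fastforce
  qed
  then show ?thesis
  proof cases
    case 1
    then have "6 * log_or_one p \<le> 7 * f"
      using w by auto
    then have "(2::real) ^ (6 * log_or_one p) \<le> 2 ^ (7 * f)"
      by (intro power_increasing) auto
    with lo7 show ?thesis by (intro generic) linarith
  next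
    case 2
    then have "p = 1" using lo hi by auto
    with assms show ?thesis by simp
  next
    case 3
    then have w': "log_or_one p = 3" using w by simp
    show ?thesis
    proof (cases "p \<ge> 6")
      case True
      then have "6 ^ 7 \<le> real p ^ 7" by (intro power_mono) auto
      then show ?thesis using w' by (intro generic) simp
    next
      case False
      then have "p \<in> set [4..<6]" using 3 lo by (simp only: set_upt) simp
      moreover have "\<not> 2 dvd p"
        using 3 lo assms by (intro prime_not_dvd) auto
      ultimately have "p = 5" by auto
      with w' show ?thesis by (auto simp: upper_defect_def)
    qed
  next
    case 4
    then have w': "log_or_one p = 5" using w by simp
    show ?thesis
    proof (cases "p \<ge> 20")
      case True
      then have "20 ^ 7 \<le> real p ^ 7" by (intro power_mono) auto
      then show ?thesis using w' by (intro generic) simp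
    next
      case False
      then have "p \<in> set [16..<20]" using 4 lo by (simp only: set_upt) simp
      moreover have "\<not> 2 dvd p"
        using 4 lo assms by (intro prime_not_dvd) auto
      ultimately have "p = 17 \<or> p = 19" by auto
      with w' show ?thesis by (auto simp: upper_defect_def)
    qed
  qed
qed

section \<open>Products over sets of primes\<close>

text \<open>Elements outside \<open>A\<close> contribute 1, and adjoining missing elements of
  \<open>A\<close> cannot decrease the product. As \<open>S\<close> is a set, each exceptional prime
  is charged at most once.\<close>

lemma prod_le_prod_support:
  fixes c :: "'a \<Rightarrow> real"
  assumes "finite S" "finite A"
    and "\<And>x. c x \<ge> 1" and "\<And>x. x \<notin> A \<Longrightarrow> c x = 1"
  shows "prod c S \<le> prod c A"
proof -
  have "prod c S = prod c (S \<inter> A)"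
    using assms by (intro prod.mono_neutral_right) auto
  also have "\<dots> \<le> prod c A"
    using assms by (intro prod_mono2) (auto intro: order_trans[OF zero_le_one])
  finally show ?thesis .
qed

lemma prod_primes_le:
  assumes "finite S" "\<And>p. p \<in> S \<Longrightarrow> prime p"
  shows "real (\<Prod>S) ^ 7 \<le> 2 ^ (8 * sum log_or_one S) * 270"
proof -
  have "real (\<Prod>S) ^ 7 = (\<Prod>p\<in>S. real p ^ 7)"
    by (simp add: prod_power_distrib)
  also have "\<dots> \<le> (\<Prod>p\<in>S. 2 ^ (8 * log_or_one p) * lower_defect p)"
    using assms power7_le_log_or_one by (intro prod_mono) auto
  also have "\<dots> = 2 ^ (8 * sum log_or_one S) * prod lower_defect S"
    by (simp add: prod.distrib power_sum sum_distrib_left)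
  also have "prod lower_defect S \<le> prod lower_defect {3, 11, 13, 53, 59, 61}"
    using assms by (intro prod_le_prod_support) (auto simp: lower_defect_def)
  \<comment> \<open>The product is about 256.5; what matters later is
    \<open>270 * 10 ^ 16 < 2 ^ 64\<close>.\<close>
  also have "\<dots> \<le> 270"
    by (simp add: lower_defect_def)
  finally show ?thesis by simp
qed

lemma prod_primes_ge:
  assumes "finite S" "\<And>p. p \<in> S \<Longrightarrow> prime p"
  shows "2 ^ (6 * sum log_or_one S) \<le> real (\<Prod>S) ^ 7 * 11"
proof -
  have "prod upper_defect S \<le> prod upper_defect {5, 17, 19}"
    using assms by (intro prod_le_prod_support) (auto simp: upper_defect_def)
  \<comment> \<open>The product is about 10.55; what matters later is
    \<open>11 ^ 2 < 2 ^ 9\<close>.\<close>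
  also have "\<dots> \<le> 11"
    by (simp add: upper_defect_def)
  finally have defect: "prod upper_defect S \<le> 11" .
  have "2 ^ (6 * sum log_or_one S) = (\<Prod>p\<in>S. (2::real) ^ (6 * log_or_one p))"
    by (simp add: power_sum sum_distrib_left)
  also have "\<dots> \<le> (\<Prod>p\<in>S. real p ^ 7 * upper_defect p)"
    using assms log_or_one_le_power7 by (intro prod_mono) auto
  also have "\<dots> = real (\<Prod>S) ^ 7 * prod upper_defect S"
    by (simp add: prod.distrib prod_power_distrib)
  also have "\<dots> \<le> real (\<Prod>S) ^ 7 * 11"
    using defect by (intro mult_left_mono) (simp_all add: prod_nonneg)
  finally show ?thesis .
qed

section \<open>Bounds on the sum of weights\<close>

lemma sum_log_or_one_ge:
  assumes "finite S" "\<And>p. p \<in> S \<Longrightarrow> prime p" and "\<Prod>S \<le> 10 ^ 16" and "2 ^ f \<le> \<Prod>S"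
  shows "f \<le> sum log_or_one S + 7"
proof (rule ccontr)
  define n w where "n = real (\<Prod>S)" and "w = sum log_or_one S"
  assume "\<not> ?thesis"
  \<comment> \<open>A failure means \<open>f \<ge> w + 8\<close>, and the gap of 8 becomes
    \<open>2 ^ 64\<close>. Of the eight factors \<open>n\<close> below, seven are bounded through
    the weights and one by \<open>10 ^ 16\<close>.\<close>
  then have "8 * w + 64 \<le> 8 * f"
    by (simp add: w_def)
  then have "(2::real) ^ (8 * w + 64) \<le> 2 ^ (8 * f)"
    by (intro power_increasing) auto
  also have "\<dots> = (2 ^ f) ^ 8"
    by (simp add: power_mult[symmetric] mult.commute)
  also have "\<dots> \<le> n ^ 8"
    using of_nat_mono[OF assms(4), where 'a = real] unfolding n_def
    by (intro power_mono) simp_all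
  also have "\<dots> = n ^ 7 * n"
    by (simp add: power_Suc2[symmetric] del: power_Suc)
  also have "\<dots> \<le> (2 ^ (8 * w) * 270) * 10 ^ 16"
    using prod_primes_le[OF assms(1,2)] of_nat_mono[OF assms(3), where 'a = real]
    unfolding n_def w_def by (intro mult_mono) (simp_all add: prod_nonneg)
  finally have "(2::real) ^ (8 * w) * 2 ^ 64 \<le> 2 ^ (8 * w) * (270 * 10 ^ 16)"
    by (simp add: power_add)
  then have "(2::real) ^ 64 \<le> 270 * 10 ^ 16"
    by (subst (asm) mult_le_cancel_left_pos) auto
  then show False by simp
qed

lemma sum_log_or_one_less:
  assumes "finite S" "\<And>p. p \<in> S \<Longrightarrow> prime p"
    and "(\<Prod>S)\<^sup>2 < 2 ^ (f + 1)" and "f \<ge> 20"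
  shows "sum log_or_one S + 7 < f"
proof (rule ccontr)
  define m w where "m = real (\<Prod>S)" and "w = sum log_or_one S"
  assume "\<not> ?thesis"
  \<comment> \<open>From \<open>w \<ge> f - 7\<close> one gets
    \<open>12 * w \<ge> 12 * f - 84\<close>, which is at least \<open>7 * f + 16\<close> exactly
    when \<open>f \<ge> 20\<close>. Squaring the product bound then brings in \<open>m ^ 14\<close>,
    the seventh power of the controlled quantity \<open>m ^ 2\<close>.\<close>
  then have "7 * (f + 1) + 9 \<le> 12 * w"
    using assms(4) by (simp add: w_def)
  then have "(2::real) ^ (7 * (f + 1) + 9) \<le> 2 ^ (12 * w)"
    by (intro power_increasing) auto
  also have "\<dots> = (2 ^ (6 * w))\<^sup>2"
    by (simp add: power_mult[symmetric])
  also have "\<dots> \<le> (m ^ 7 * 11)\<^sup>2"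
    using prod_primes_ge[OF assms(1,2)] unfolding m_def w_def by (intro power_mono) auto
  also have "\<dots> = (m\<^sup>2) ^ 7 * 121"
    by (simp add: power_mult_distrib power_mult[symmetric])
  also have "\<dots> \<le> (2 ^ (f + 1)) ^ 7 * 121"
  proof -
    have "m\<^sup>2 \<le> 2 ^ (f + 1)"
      using of_nat_mono[OF less_imp_le[OF assms(3)], where 'a = real] unfolding m_def by simp
    then show ?thesis
      by (intro mult_right_mono power_mono) auto
  qed
  also have "(2 ^ (f + 1)) ^ 7 = (2::real) ^ (7 * (f + 1))"
    by (subst power_mult[symmetric]) (simp only: mult.commute)
  finally have "(2::real) ^ (7 * (f + 1)) * 2 ^ 9 \<le> 2 ^ (7 * (f + 1)) * 121"
    by (simp only: power_add)
  then have "(2::real) ^ 9 \<le> 121"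
    by (subst (asm) mult_le_cancel_left_pos) auto
  then show False by simp
qed

theorem theorem1:
  fixes n k :: nat and p :: "nat \<Rightarrow> nat"
  assumes "2 ^ 20 < n" and "n \<le> 10 ^ 16"
    and "squarefree n"
    and "n = (\<Prod>j = 1..k. p j)"
    and "\<And>j. j \<in> {1..k} \<Longrightarrow> prime (p j)"
    and "inj_on p {1..k}"
  shows "(\<Sum>j = 1..k. \<lfloor>log 2 (real (p j))\<rfloor> OR 1) \<ge> \<lfloor>log 2 (real n)\<rfloor> - 7
    \<and> (real (p k) > sqrt (real n) \<longrightarrow>
        (\<Sum>j = 1..k - 1. \<lfloor>log 2 (real (p j))\<rfloor> OR 1) < \<lfloor>log 2 (real n)\<rfloor> - 7)"
proof -
  have "n > 0" using assms(1) by simp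
  then obtain f where f: "\<lfloor>log 2 (real n)\<rfloor> = int f" "2 ^ f \<le> n" "n < 2 ^ (f + 1)"
    by (rule floor_log2_obtain)
  \<comment> \<open>Injectivity of \<open>p\<close> lets sums and products over indices become ones
    over sets of primes.\<close>
  have sum_eq: "(\<Sum>j\<in>J. \<lfloor>log 2 (real (p j))\<rfloor> OR 1) = int (sum log_or_one (p ` J))"
    and prod_eq: "\<Prod>(p ` J) = prod p J" if "J \<subseteq> {1..k}" for J
  proof -
    have inj: "inj_on p J"
      using assms(6) that by (rule inj_on_subset)
    then show "\<Prod>(p ` J) = prod p J"
      by (simp add: prod.reindex)
    have "\<lfloor>log 2 (real (p j))\<rfloor> OR 1 = int (log_or_one (p j))" if "j \<in> J" for j
      using \<open>J \<subseteq> {1..k}\<close> that assms(5) prime_gt_0_nat by (subst int_log_or_one) auto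
    then show "(\<Sum>j\<in>J. \<lfloor>log 2 (real (p j))\<rfloor> OR 1) = int (sum log_or_one (p ` J))"
      using inj by (simp add: sum.reindex)
  qed
  have "f \<le> sum log_or_one (p ` {1..k}) + 7"
    by (rule sum_log_or_one_ge) (use assms f prod_eq in auto)
  moreover have "sum log_or_one (p ` {1..k - 1}) + 7 < f" if large: "real (p k) > sqrt (real n)"
  proof (rule sum_log_or_one_less)
    define m where "m = (\<Prod>j = 1..k - 1. p j)"
    have "k \<noteq> 0"
      using assms(1,4) by (intro notI) simp
    then have n: "n = m * p k"
      using assms(4) by (cases k) (simp_all add: m_def)
    have "sqrt (real n) ^ 2 < real (p k) ^ 2"
      using large by (intro power_strict_mono) auto
    then have "real n < real ((p k)\<^sup>2)"
      by simp
    then have "n < (p k)\<^sup>2"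
      by (simp only: of_nat_less_iff)
    \<comment> \<open>Cancel \<open>p k\<close> in \<open>m * p k < (p k) ^ 2\<close>; multiplying
      the result by \<open>m\<close> gives \<open>m ^ 2 < n\<close>.\<close>
    then have "m < p k"
      by (simp add: n power2_eq_square)
    moreover have "m > 0"
      using n \<open>n > 0\<close> by simp
    ultimately have "m\<^sup>2 < n"
      by (simp add: n power2_eq_square)
    then show "(\<Prod>(p ` {1..k - 1}))\<^sup>2 < 2 ^ (f + 1)"
      using f(3) prod_eq[of "{1..k - 1}"] by (simp add: m_def)
    have "(2::nat) ^ 20 < 2 ^ (f + 1)"
      using assms(1) f(3) by (rule less_trans)
    then have "20 < f + 1"
      by (subst (asm) power_strict_increasing_iff) auto
    then show "f \<ge> 20" by simp
  qed (use assms(5) in auto)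
  ultimately show ?thesis
    using sum_eq[of "{1..k}"] sum_eq[of "{1..k - 1}"] f(1) by (auto simp del: of_nat_sum)
qed

end
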